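(* Let $u_1,u_2$ satisfy Condition U (see context). Let $q\in\mathscr W_1^0$ and let $p=P(q)$ be defined by $$p=q'+q^2+u-c_0,\qquad c_0=\int_0^1(q^2+u)\,dt,\qquad u=u_1(q)+u_2(Q),\qquad Q(x)=\int_0^xq(t)\,dt.$$ Then the operators $S_p$ and $-\Delta_q$ (see context) are unitarily equivalent. In particular, they have the same boundary conditions, eigenvalues and norming constants.
   Context: All functions are real-valued on $(0,1)$; $\|\cdot\|$ is the norm of $L^2(0,1)=L^2((0,1);dx)$, $H^1$ is the Sobolev space of order 1 on $(0,1)$, and $\mathscr W_1^0=\{q\in H^1: q(0)=q(1)=0\}$. Condition U: $u_1,u_2:\mathbb R\to\mathbb R$ are real analytic, $u_2'(t)\le 0$ for all $t\in\mathbb R$, and there are nondecreasing functions $F_1,F_2:[0,\infty)\to[0,\infty)$ such that $\|u_1'(q)\|\le F_1(\|q'\|)$ and $\|u_2'(Q)\|\le F_2(\|q\|)$ for all $q\in\mathscr W_1^0$, where $Q(x)=\int_0^x q\,dt$. Operators: with $\rho(x)=e^{Q(x)}$, $-\Delta_q f=-\frac1{\rho^2}(\rho^2f')'+uf$ acts in $L^2((0,1);\rho^2dx)$, and $S_p y=-y''+py$ acts in $L^2(0,1)$. Both are considered on $(0,1)$ subject to the boundary condition $f'(0)-af(0)=0$, $f'(1)+bf(1)=0$, where $a,b\in\mathbb R\cup\{\infty\}$; $a=\infty$ means $f(0)=0$ and $b=\infty$ means $f(1)=0$. Norming constants: let $f_n$ (resp. $y_n$) be the $n$-th eigenfunction of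 $-\Delta_q$ (resp. $S_p$). For $-\Delta_q$ the $n$-th norming constant is $\log\left|\frac{\rho(1)f_n'(1)}{f_n'(0)}\right|$ if $a=b=\infty$; $\log\left|\frac{\rho(1)f_n(1)}{f_n'(0)}\right|$ if $a=\infty$, $b\in\mathbb R$; $\log\left|\frac{\rho(1)f_n(1)}{f_n(0)}\right|$ if $a,b\in\mathbb R$. For $S_p$ it is, respectively, $\log\left|\frac{y_n'(1)}{y_n'(0)}\right|$, $\log\left|\frac{y_n(1)}{y_n'(0)}\right|$, $\log\left|\frac{y_n(1)}{y_n(0)}\right|$.
   Formalization: The claim is false unless c_0=0 (take u_1=u_2=0, q≠0: the lowest eigenvalues differ by c_0); corrected: S_p+c_0, not S_p, is unitarily equivalent to -Δ_q, and the eigenvalues of -Δ_q are those of S_p shifted by c_0; norming constants agree as stated. *)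

theory Defs
  imports "HOL-Analysis.Analysis"
begin

text \<open>Functions on the unit interval are total functions on the reals of which only the values
  on the interval matter. \<open>lspace M\<close> is the real Hilbert space of square-integrable functions,
  before identifying functions that agree almost everywhere.\<close>

abbreviation unit_interval_measure :: "real measure" where
  "unit_interval_measure \<equiv> lebesgue_on {0<..<1}"

definition lspace :: "real measure \<Rightarrow> (real \<Rightarrow> real) set" where
  "lspace M = {f \<in> borel_measurable M. integrable M (\<lambda>x. (f x)\<^sup>2)}"

definition weighted :: "(real \<Rightarrow> real) \<Rightarrow> real measure" where
  "weighted w = density unit_interval_measure (\<lambda>x. ennreal (w x))"

definition l2norm :: "(real \<Rightarrow> real) \<Rightarrow> real" where
  "l2norm f = sqrt (LINT x|unit_interval_measure. (f x)\<^sup>2)"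


text \<open>\<open>H1\<close> consists of the continuous representatives on the closed interval, so that boundary
  values make sense: the absolutely continuous functions with square-integrable derivative.
  The weak derivative is determined up to a null set; \<open>wderiv\<close> picks one version.\<close>

definition has_l2_deriv :: "(real \<Rightarrow> real) \<Rightarrow> (real \<Rightarrow> real) \<Rightarrow> bool" where
  "has_l2_deriv f g \<longleftrightarrow> g \<in> lspace unit_interval_measure \<and>
     (\<forall>x\<in>{0..1}. f x = f 0 + (LINT t:{0..x}|lebesgue. g t))"

definition H1 :: "(real \<Rightarrow> real) set" where
  "H1 = {f. \<exists>g. has_l2_deriv f g}"

definition wderiv :: "(real \<Rightarrow> real) \<Rightarrow> real \<Rightarrow> real" where
  "wderiv f = (SOME g. has_l2_deriv f g)"

definition W10 :: "(real \<Rightarrow> real) set" where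
  "W10 = {q \<in> H1. q 0 = 0 \<and> q 1 = 0}"

definition primitive :: "(real \<Rightarrow> real) \<Rightarrow> real \<Rightarrow> real" where
  "primitive q x = (LINT t:{0..x}|lebesgue. q t)"


definition real_analytic :: "(real \<Rightarrow> real) \<Rightarrow> bool" where
  "real_analytic u \<longleftrightarrow>
     (\<forall>x0. \<exists>c r. r > 0 \<and> (\<forall>x. \<bar>x - x0\<bar> < r \<longrightarrow> (\<lambda>n. c n * (x - x0) ^ n) sums u x))"

definition condition_U :: "(real \<Rightarrow> real) \<Rightarrow> (real \<Rightarrow> real) \<Rightarrow> bool" where
  "condition_U u1 u2 \<longleftrightarrow>
     real_analytic u1 \<and> real_analytic u2 \<and> (\<forall>t. deriv u2 t \<le> 0) \<and>
     (\<exists>F1 F2 :: real \<Rightarrow> real.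
        F1 \<in> {0..} \<rightarrow> {0..} \<and> mono_on {0..} F1 \<and> F2 \<in> {0..} \<rightarrow> {0..} \<and> mono_on {0..} F2 \<and>
        (\<forall>q\<in>W10. l2norm (\<lambda>x. deriv u1 (q x)) \<le> F1 (l2norm (wderiv q)) \<and>
                  l2norm (\<lambda>x. deriv u2 (primitive q x)) \<le> F2 (l2norm q)))"


text \<open>\<open>Fin a\<close> with a real and \<open>Infinite\<close> are the admissible boundary parameters. \<open>D f\<close> is the
  classical derivative on the closed unit interval, one-sided at the end points.\<close>

datatype bparam = Fin real | Infinite

definition D :: "(real \<Rightarrow> real) \<Rightarrow> real \<Rightarrow> real" where
  "D f x = vector_derivative f (at x within {0..1})"

definition bc :: "bparam \<Rightarrow> bparam \<Rightarrow> (real \<Rightarrow> real) \<Rightarrow> bool" where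
  "bc a b f \<longleftrightarrow>
     (case a of Fin \<alpha> \<Rightarrow> D f 0 - \<alpha> * f 0 = 0 | Infinite \<Rightarrow> f 0 = 0) \<and>
     (case b of Fin \<beta> \<Rightarrow> D f 1 + \<beta> * f 1 = 0 | Infinite \<Rightarrow> f 1 = 0)"


text \<open>An operator is a domain of classical representatives together with its action. The domains
  are the maximal ones: the functions for which the differential expression makes sense and is
  square-integrable, subject to the boundary condition. As the potentials are square-integrable and
  functions in the domain bounded, this amounts to the (quasi-)derivative lying in \<open>H1\<close>.\<close>

type_synonym operator = "(real \<Rightarrow> real) set \<times> ((real \<Rightarrow> real) \<Rightarrow> real \<Rightarrow> real)"

definition schroedinger :: "(real \<Rightarrow> real) \<Rightarrow> bparam \<Rightarrow> bparam \<Rightarrow> operator" where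
  "schroedinger p a b =
     ({y. y differentiable_on {0..1} \<and> D y \<in> H1 \<and> bc a b y},
      \<lambda>y x. - wderiv (D y) x + p x * y x)"

definition rho :: "(real \<Rightarrow> real) \<Rightarrow> real \<Rightarrow> real" where
  "rho q x = exp (primitive q x)"

definition neg_laplacian :: "(real \<Rightarrow> real) \<Rightarrow> (real \<Rightarrow> real) \<Rightarrow> bparam \<Rightarrow> bparam \<Rightarrow> operator" where
  "neg_laplacian q u a b =
     ({f. f differentiable_on {0..1} \<and> (\<lambda>x. (rho q x)\<^sup>2 * D f x) \<in> H1 \<and> bc a b f},
      \<lambda>f x. - (1 / (rho q x)\<^sup>2) * wderiv (\<lambda>t. (rho q t)\<^sup>2 * D f t) x + u x * f x)"

definition add_const :: "operator \<Rightarrow> real \<Rightarrow> operator" where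
  "add_const A c = (fst A, \<lambda>f x. snd A f x + c * f x)"


text \<open>The operator in \<open>lspace M\<close> is the graph, saturated under almost-everywhere equality.
  For graphs \<open>G\<close> and \<open>H\<close> of this kind and unitary \<open>U\<close>, the equivalence below expresses
  \<open>U G U\<inverse> = H\<close> including equality of the domains.\<close>

definition op_graph :: "real measure \<Rightarrow> operator \<Rightarrow> ((real \<Rightarrow> real) \<times> (real \<Rightarrow> real)) set" where
  "op_graph M A = {(f, g). f \<in> lspace M \<and> g \<in> lspace M \<and>
     (\<exists>f0\<in>fst A. (AE x in M. f x = f0 x) \<and> (AE x in M. g x = snd A f0 x))}"

definition unitary_map ::
  "real measure \<Rightarrow> real measure \<Rightarrow> ((real \<Rightarrow> real) \<Rightarrow> real \<Rightarrow> real) \<Rightarrow> bool" where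
  "unitary_map M N U \<longleftrightarrow>
     (\<forall>f\<in>lspace M. U f \<in> lspace N) \<and>
     (\<forall>f\<in>lspace M. \<forall>g\<in>lspace M. \<forall>c d.
        AE x in N. U (\<lambda>t. c * f t + d * g t) x = c * U f x + d * U g x) \<and>
     (\<forall>f\<in>lspace M. \<forall>g\<in>lspace M. (LINT x|N. U f x * U g x) = (LINT x|M. f x * g x)) \<and>
     (\<forall>h\<in>lspace N. \<exists>f\<in>lspace M. AE x in N. U f x = h x)"

definition unitarily_equivalent ::
  "real measure \<Rightarrow> operator \<Rightarrow> real measure \<Rightarrow> operator \<Rightarrow> bool" where
  "unitarily_equivalent M A N B \<longleftrightarrow>
     (\<exists>U. unitary_map M N U \<and>
        (\<forall>f\<in>lspace M. \<forall>g\<in>lspace M. (f, g) \<in> op_graph M A \<longleftrightarrow> (U f, U g) \<in> op_graph N B))"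


text \<open>Eigenvalues are simple for the separated boundary conditions used here, so that the position
  of an eigenvalue is the number of smaller eigenvalues; counting starts at 0.\<close>

definition eigenfunction :: "real measure \<Rightarrow> operator \<Rightarrow> real \<Rightarrow> (real \<Rightarrow> real) \<Rightarrow> bool" where
  "eigenfunction M A \<mu> f \<longleftrightarrow>
     f \<in> fst A \<and> (AE x in M. snd A f x = \<mu> * f x) \<and> \<not> (AE x in M. f x = 0)"

definition eigenvalue :: "real measure \<Rightarrow> operator \<Rightarrow> real \<Rightarrow> bool" where
  "eigenvalue M A \<mu> \<longleftrightarrow> (\<exists>f. eigenfunction M A \<mu> f)"

definition nth_eigenvalue :: "real measure \<Rightarrow> operator \<Rightarrow> nat \<Rightarrow> real \<Rightarrow> bool" where
  "nth_eigenvalue M A n \<mu> \<longleftrightarrow> eigenvalue M A \<mu> \<and>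
     finite {\<nu>. eigenvalue M A \<nu> \<and> \<nu> < \<mu>} \<and> card {\<nu>. eigenvalue M A \<nu> \<and> \<nu> < \<mu>} = n"

definition nth_eigenfunction :: "real measure \<Rightarrow> operator \<Rightarrow> nat \<Rightarrow> (real \<Rightarrow> real) \<Rightarrow> bool" where
  "nth_eigenfunction M A n f \<longleftrightarrow> (\<exists>\<mu>. nth_eigenvalue M A n \<mu> \<and> eigenfunction M A \<mu> f)"


text \<open>Norming constants are not defined for real \<open>a\<close> and infinite \<open>b\<close>.\<close>

fun norming_laplacian ::
  "(real \<Rightarrow> real) \<Rightarrow> bparam \<Rightarrow> bparam \<Rightarrow> (real \<Rightarrow> real) \<Rightarrow> real" where
  "norming_laplacian q Infinite Infinite f = ln \<bar>rho q 1 * D f 1 / D f 0\<bar>"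
| "norming_laplacian q Infinite (Fin \<beta>) f = ln \<bar>rho q 1 * f 1 / D f 0\<bar>"
| "norming_laplacian q (Fin \<alpha>) (Fin \<beta>) f = ln \<bar>rho q 1 * f 1 / f 0\<bar>"
| "norming_laplacian q (Fin \<alpha>) Infinite f = undefined"

fun norming_schroedinger ::
  "bparam \<Rightarrow> bparam \<Rightarrow> (real \<Rightarrow> real) \<Rightarrow> real" where
  "norming_schroedinger Infinite Infinite y = ln \<bar>D y 1 / D y 0\<bar>"
| "norming_schroedinger Infinite (Fin \<beta>) y = ln \<bar>y 1 / D y 0\<bar>"
| "norming_schroedinger (Fin \<alpha>) (Fin \<beta>) y = ln \<bar>y 1 / y 0\<bar>"
| "norming_schroedinger (Fin \<alpha>) Infinite y = undefined"

end

theory Submission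
  imports Defs
begin

text \<open>Since \<open>rho' = q rho\<close>, the substitution \<open>y = rho f\<close> turns the \<open>L\<^sup>2\<close> norm weighted by \<open>rho\<^sup>2\<close> into the
  unweighted one and gives \<open>(rho\<^sup>2 f')' = rho (y'' - (q' + q\<^sup>2) y)\<close>; so it conjugates the weighted operator
  into \<open>S\<^sub>p + c0\<close>. As \<open>q\<close> vanishes at both end points, boundary conditions are preserved. Norming
  constants do not depend on the choice of the eigenfunction because eigenvalues are simple, which is
  uniqueness for the initial value problem with an integrable potential.\<close>

subsection \<open>Absolutely continuous functions with square-integrable derivative\<close>

text \<open>The derivative of \<open>q\<close> integrates to \<open>q 1 - q 0 = 0\<close>, so
  subtracting \<open>c0\<close> makes \<open>p\<close> a potential of mean zero. The price is a
  shift of the spectrum, which the statement carries as \<open>add_const\<close> and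
  \<open>\<mu> + c0\<close>. The obstacle is low regularity. The derivative of \<open>q\<close> is
  merely square-integrable and \<open>wderiv\<close> picks an arbitrary version of it, so the
  differential identities hold only almost everywhere; they rest on a product rule for absolutely
  continuous functions and on uniqueness of the derivative up to null sets. Likewise the potential
  in the initial value problem may be unbounded, so its uniqueness argument uses smallness of
  integrals of the coefficient on short intervals in place of a Lipschitz constant. Analyticity of
  \<open>u1\<close> and \<open>u2\<close> makes \<open>u\<close> continuous, which puts
  \<open>p\<close> among the integrable potentials. In the norming constants \<open>f\<close> and
  \<open>y\<close> are chosen independently of each other: simplicity gives
  \<open>rho f = k y\<close> with \<open>k\<close> nonzero, and \<open>k\<close> cancels in every
  quotient.\<close>

lemma lspace_absolutely_integrable:
  assumes "g \<in> lspace unit_interval_measure"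
  shows "g absolutely_integrable_on {0..1}"
proof -
  have "integrable unit_interval_measure (\<lambda>x. 1 + (g x)\<^sup>2)"
    using assms by (auto simp: lspace_def integrable_restrict_space set_integrable_def[symmetric]
        absolutely_integrable_on_const intro!: Bochner_Integration.integrable_add)
  moreover have "\<bar>t\<bar> \<le> 1 + t\<^sup>2" for t :: real
    using zero_le_power2[of "\<bar>t\<bar> - 1"] by (simp add: power2_diff)
  ultimately have "integrable unit_interval_measure g"
    using assms by (auto simp: lspace_def intro: Bochner_Integration.integrable_bound)
  then have "g absolutely_integrable_on box 0 1"
    by (simp add: integrable_restrict_space set_integrable_def)
  then show ?thesis
    by (metis absolutely_integrable_on_open_interval box_real(2))
qed

lemma lspace_integral:
  assumes "g \<in> lspace unit_interval_measure" "0 \<le> x" "x \<le> 1"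
  shows "g absolutely_integrable_on {0..x}" "(LINT t:{0..x}|lebesgue. g t) = integral {0..x} g"
proof -
  show "g absolutely_integrable_on {0..x}"
    using lspace_absolutely_integrable[OF assms(1)] assms
    by (elim set_integrable_subset) auto
  then show "(LINT t:{0..x}|lebesgue. g t) = integral {0..x} g"
    by (rule set_lebesgue_integral_eq_integral)
qed

text \<open>Absolute integrability makes the Lebesgue integral of the definition agree with the
  gauge integral \<open>integral\<close>, for which splitting of intervals, spikes and the
  fundamental theorem are at hand.\<close>

lemma has_l2_deriv_iff:
  "has_l2_deriv f g \<longleftrightarrow> g \<in> lspace unit_interval_measure \<and>
     (\<forall>x\<in>{0..1}. f x = f 0 + integral {0..x} g)"
  unfolding has_l2_deriv_def
  by (intro conj_cong refl ball_cong) (simp add: lspace_integral(2))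

lemma has_l2_deriv_eq: "has_l2_deriv f g \<Longrightarrow> x \<in> {0..1} \<Longrightarrow> f x = f 0 + integral {0..x} g"
  unfolding has_l2_deriv_iff by blast

lemma has_l2_derivD:
  assumes "has_l2_deriv f g" "0 \<le> x" "x \<le> y" "y \<le> 1"
  shows "g absolutely_integrable_on {x..y}" "f y - f x = integral {x..y} g"
proof -
  have g: "g absolutely_integrable_on {0..1}"
    using assms lspace_absolutely_integrable unfolding has_l2_deriv_def by auto
  from g show "g absolutely_integrable_on {x..y}"
    by (rule set_integrable_subset) (use assms in auto)
  have "integral {0..x} g + integral {x..y} g = integral {0..y} g"
    by (rule Henstock_Kurzweil_Integration.integral_combine)
      (use assms lspace_integral(1)[of g y] in \<open>auto simp: has_l2_deriv_def set_lebesgue_integral_eq_integral\<close>)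
  moreover have "f x = f 0 + integral {0..x} g" "f y = f 0 + integral {0..y} g"
    using assms by (auto intro!: has_l2_deriv_eq[OF assms(1)])
  ultimately show "f y - f x = integral {x..y} g" by simp
qed

lemma has_l2_deriv_continuous:
  assumes "has_l2_deriv f g" shows "continuous_on {0..1} f"
proof -
  have "g integrable_on {0..1}"
    using assms lspace_absolutely_integrable unfolding has_l2_deriv_def
    by (auto simp: set_lebesgue_integral_eq_integral)
  then have "continuous_on {0..1} (\<lambda>x. f 0 + integral {0..x} g)"
    by (intro continuous_intros indefinite_integral_continuous_1)
  then show ?thesis
    by (rule continuous_on_eq) (rule has_l2_deriv_eq[OF assms, symmetric])
qed

lemma continuous_on_measurable_unit:
  assumes "continuous_on {0..1} (f :: real \<Rightarrow> real)"
  shows "f \<in> borel_measurable unit_interval_measure"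
  using assms by (intro continuous_imp_measurable_on_sets_lebesgue)
    (auto elim: continuous_on_subset)

lemma lspace_add:
  assumes "f \<in> lspace M" "g \<in> lspace M"
  shows "(\<lambda>x. f x + g x) \<in> lspace M"
proof -
  have m: "f \<in> borel_measurable M" "g \<in> borel_measurable M"
    using assms by (auto simp: lspace_def)
  have "integrable M (\<lambda>x. 2 * (f x)\<^sup>2 + 2 * (g x)\<^sup>2)"
    using assms by (auto simp: lspace_def)
  then have "integrable M (\<lambda>x. (f x + g x)\<^sup>2)"
  proof (rule Bochner_Integration.integrable_bound)
    have "(s + t)\<^sup>2 \<le> 2 * s\<^sup>2 + 2 * t\<^sup>2" for s t :: real
      using zero_le_power2[of "s - t"] by (simp add: power2_diff power2_sum)
    then show "AE x in M. norm ((f x + g x)\<^sup>2) \<le> norm (2 * (f x)\<^sup>2 + 2 * (g x)\<^sup>2)"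
      by simp
  qed (use m in measurable)
  then show ?thesis using m by (simp add: lspace_def)
qed

lemma lspace_mult_continuous:
  assumes f: "continuous_on {0..1} f" and g: "g \<in> lspace unit_interval_measure"
  shows "(\<lambda>x. f x * g x) \<in> lspace unit_interval_measure"
proof -
  obtain C where C: "\<And>x. x \<in> {0..1} \<Longrightarrow> \<bar>f x\<bar> \<le> C"
    using compact_imp_bounded[OF compact_continuous_image[OF f compact_Icc]]
    unfolding bounded_iff real_norm_def by blast
  have m: "(\<lambda>x. f x * g x) \<in> borel_measurable unit_interval_measure"
    using g continuous_on_measurable_unit[OF f] by (auto simp: lspace_def)
  have "integrable unit_interval_measure (\<lambda>x. C\<^sup>2 * (g x)\<^sup>2)"
    using g by (auto simp: lspace_def)
  then have "integrable unit_interval_measure (\<lambda>x. (f x * g x)\<^sup>2)"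
  proof (rule Bochner_Integration.integrable_bound)
    have "(f x)\<^sup>2 * (g x)\<^sup>2 \<le> C\<^sup>2 * (g x)\<^sup>2" if "x \<in> {0..1}" for x
      using C[OF that] power_mono[of "\<bar>f x\<bar>" C 2] by (intro mult_right_mono) auto
    then show "AE x in unit_interval_measure. norm ((f x * g x)\<^sup>2) \<le> norm (C\<^sup>2 * (g x)\<^sup>2)"
      by (intro AE_I2) (simp add: power_mult_distrib)
  qed (use m in measurable)
  then show ?thesis using m by (simp add: lspace_def)
qed

lemma lspace_continuous:
  assumes "continuous_on {0..1} f"
  shows "f \<in> lspace unit_interval_measure"
proof -
  have "(\<lambda>x. 1) \<in> lspace unit_interval_measure"
    by (auto simp: lspace_def integrable_restrict_space set_integrable_def[symmetric]
        absolutely_integrable_on_const)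
  from lspace_mult_continuous[OF assms this] show ?thesis by simp
qed

lemma has_l2_deriv_cong:
  assumes "\<And>x. x \<in> {0..1} \<Longrightarrow> f x = f' x"
  shows "has_l2_deriv f g \<longleftrightarrow> has_l2_deriv f' g"
  unfolding has_l2_deriv_def by (intro conj_cong refl ball_cong) (simp_all add: assms)

text \<open>The predicates \<open>has_l2_deriv f\<close> and \<open>has_l2_deriv f'\<close> are
  equal, so the choice operator selects literally the same version, not just one that agrees almost
  everywhere.\<close>

lemma H1_cong:
  assumes "\<And>x. x \<in> {0..1} \<Longrightarrow> f x = f' x"
  shows "f \<in> H1 \<longleftrightarrow> f' \<in> H1" "wderiv f = wderiv f'"
proof -
  have "has_l2_deriv f = has_l2_deriv f'"
    by (intro ext has_l2_deriv_cong assms)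
  then show "f \<in> H1 \<longleftrightarrow> f' \<in> H1" "wderiv f = wderiv f'"
    by (simp_all add: H1_def wderiv_def)
qed

lemma H1_wderiv: "f \<in> H1 \<Longrightarrow> has_l2_deriv f (wderiv f)"
  using someI_ex[of "has_l2_deriv f"] unfolding H1_def wderiv_def by blast

lemma has_l2_deriv_lincomb:
  assumes "has_l2_deriv f f'" "has_l2_deriv g g'"
  shows "has_l2_deriv (\<lambda>x. c * f x + d * g x) (\<lambda>x. c * f' x + d * g' x)"
proof -
  have l: "f' \<in> lspace unit_interval_measure" "g' \<in> lspace unit_interval_measure"
    using assms by (auto simp: has_l2_deriv_def)
  have "c * f x + d * g x = c * f 0 + d * g 0 + integral {0..x} (\<lambda>x. c * f' x + d * g' x)"
    if x: "x \<in> {0..1}" for x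
  proof -
    have "f' integrable_on {0..x}" "g' integrable_on {0..x}"
      using lspace_integral(1) l x by (auto simp: set_lebesgue_integral_eq_integral)
    then have "integral {0..x} (\<lambda>x. c * f' x + d * g' x) = c * integral {0..x} f' + d * integral {0..x} g'"
      by (subst Henstock_Kurzweil_Integration.integral_add) (auto intro: integrable_on_mult_right)
    moreover have "f x = f 0 + integral {0..x} f'" "g x = g 0 + integral {0..x} g'"
      using assms x unfolding has_l2_deriv_iff by blast+
    ultimately show ?thesis by (simp add: algebra_simps)
  qed
  moreover have "(\<lambda>x. c * f' x + d * g' x) \<in> lspace unit_interval_measure"
    by (intro lspace_add lspace_mult_continuous l continuous_intros)
  ultimately show ?thesis unfolding has_l2_deriv_iff by blast
qed

lemma has_l2_deriv_C1:
  assumes d: "\<And>x. x \<in> {0..1} \<Longrightarrow> (f has_vector_derivative f' x) (at x within {0..1})"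
    and c: "continuous_on {0..1} f'"
  shows "has_l2_deriv f f'"
proof -
  have "f x = f 0 + integral {0..x} f'" if "x \<in> {0..1}" for x
  proof -
    have "(f' has_integral (f x - f 0)) {0..x}"
      by (rule fundamental_theorem_of_calculus)
        (use that in \<open>auto intro!: has_vector_derivative_within_subset[OF d]\<close>)
    then show ?thesis by (simp add: integral_unique)
  qed
  then show ?thesis
    unfolding has_l2_deriv_iff using lspace_continuous[OF c] by blast
qed

section \<open>The product rule for absolutely continuous functions\<close>

text \<open>A chain of steps of length at most \<open>\<delta>\<close> leads from 0 to
  \<open>x\<close>: the triangle inequality adds up the increments of \<open>h\<close>, while those
  of \<open>H\<close> telescope. The induction is on the number of steps.\<close>

lemma increments_le_of_local:
  fixes h H :: "real \<Rightarrow> real"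
  assumes "\<delta> > 0"
    and step: "\<And>x y. \<lbrakk>0 \<le> x; x \<le> y; y \<le> 1; y - x \<le> \<delta>\<rbrakk> \<Longrightarrow> \<bar>h y - h x\<bar> \<le> H y - H x"
    and x: "x \<in> {0..1}"
  shows "\<bar>h x - h 0\<bar> \<le> H x - H 0"
proof -
  have *: "x \<in> {0..1} \<Longrightarrow> x \<le> real n * \<delta> \<Longrightarrow> \<bar>h x - h 0\<bar> \<le> H x - H 0" for n x
  proof (induction n arbitrary: x)
    case 0
    then show ?case by simp
  next
    case (Suc n)
    show ?case
    proof (cases "x \<le> \<delta>")
      case True
      then show ?thesis using step[of 0 x] Suc by auto
    next
      case False
      then have "\<bar>h (x - \<delta>) - h 0\<bar> \<le> H (x - \<delta>) - H 0"
        using Suc \<open>\<delta> > 0\<close> by (intro Suc.IH) (auto simp: algebra_simps)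
      moreover have "\<bar>h x - h (x - \<delta>)\<bar> \<le> H x - H (x - \<delta>)"
        using False Suc \<open>\<delta> > 0\<close> by (intro step) auto
      ultimately show ?thesis by linarith
    qed
  qed
  obtain n where "x / \<delta> \<le> real n"
    using real_arch_simple by blast
  then have "x \<le> real n * \<delta>"
    using \<open>\<delta> > 0\<close> by (simp add: field_simps)
  with * x show ?thesis by blast
qed

text \<open>On short intervals the increments of \<open>f g - \<integral>(f' g + f g')\<close> are at most \<open>\<epsilon>\<close> times those of
  \<open>\<integral>(\<bar>f'\<bar> + \<bar>g'\<bar>)\<close>, by uniform continuity of \<open>f\<close> and \<open>g\<close>; this avoids Fubini's theorem.\<close>

lemma has_l2_deriv_mult:
  assumes f: "has_l2_deriv f f'" and g: "has_l2_deriv g g'"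
  shows "has_l2_deriv (\<lambda>x. f x * g x) (\<lambda>x. f' x * g x + f x * g' x)"
proof -
  note cf = has_l2_deriv_continuous[OF f] and cg = has_l2_deriv_continuous[OF g]
  define k where "k = (\<lambda>x. f' x * g x + f x * g' x)"
  have l: "f' \<in> lspace unit_interval_measure" "g' \<in> lspace unit_interval_measure"
    using f g by (auto simp: has_l2_deriv_def)
  have k: "k \<in> lspace unit_interval_measure"
    unfolding k_def using lspace_mult_continuous[OF cf l(2)] lspace_mult_continuous[OF cg l(1)]
    by (auto intro!: lspace_add simp: mult.commute)
  define e where "e = (\<lambda>t. \<bar>f' t\<bar> + \<bar>g' t\<bar>)"
  have ai: "f' absolutely_integrable_on {x..y}" "g' absolutely_integrable_on {x..y}"
      "k absolutely_integrable_on {x..y}" "e integrable_on {x..y}"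
      if "0 \<le> x" "y \<le> 1" for x y
  proof -
    have sub: "{x..y} \<subseteq> {0..1}" using that by auto
    show a: "f' absolutely_integrable_on {x..y}" "g' absolutely_integrable_on {x..y}"
      "k absolutely_integrable_on {x..y}"
      by (rule set_integrable_subset[OF lspace_absolutely_integrable _ sub], use k l in auto)+
    show "e integrable_on {x..y}"
      unfolding e_def using a
      by (intro integrable_add) (auto simp: absolutely_integrable_on_def)
  qed
  \<comment> \<open>The defect of the product formula; the aim is that \<open>h\<close> is
    constant.\<close>
  define h where "h = (\<lambda>x. f x * g x - integral {0..x} k)"
  define H where "H = (\<lambda>x. integral {0..x} e)"
  have comb: "integral {0..y} k - integral {0..x} k = integral {x..y} k"
       "H y - H x = integral {x..y} e"
    if "0 \<le> x" "x \<le> y" "y \<le> 1" for x y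
    using Henstock_Kurzweil_Integration.integral_combine[of 0 x y k]
      Henstock_Kurzweil_Integration.integral_combine[of 0 x y e] that ai[of 0 y]
    by (auto simp: H_def set_lebesgue_integral_eq_integral)
  have "\<bar>h x - h 0\<bar> \<le> \<epsilon> * H x" if x: "x \<in> {0..1}" and eps: "\<epsilon> > 0" for x \<epsilon>
  proof -
    obtain d1 where d1: "d1 > 0"
      "\<And>x y. \<lbrakk>x \<in> {0..1}; y \<in> {0..1}; \<bar>x - y\<bar> < d1\<rbrakk> \<Longrightarrow> \<bar>f x - f y\<bar> < \<epsilon>"
      using compact_uniformly_continuous[OF cf compact_Icc] eps
      unfolding uniformly_continuous_on_def dist_real_def by metis
    obtain d2 where d2: "d2 > 0"
      "\<And>x y. \<lbrakk>x \<in> {0..1}; y \<in> {0..1}; \<bar>x - y\<bar> < d2\<rbrakk> \<Longrightarrow> \<bar>g x - g y\<bar> < \<epsilon>"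
      using compact_uniformly_continuous[OF cg compact_Icc] eps
      unfolding uniformly_continuous_on_def dist_real_def by metis
    \<comment> \<open>Halving turns the non-strict bound \<open>y - x \<le> d\<close> into the
      strict bounds required by uniform continuity.\<close>
    define d where "d = min d1 d2 / 2"
    have "\<bar>h y - h x\<bar> \<le> \<epsilon> * H y - \<epsilon> * H x"
      if xy: "0 \<le> x" "x \<le> y" "y \<le> 1" "y - x \<le> d" for x y
    proof -
      have d: "d < d1" "d < d2" using d1 d2 by (auto simp: d_def)
      have I: "f' integrable_on {x..y}" "g' integrable_on {x..y}" "k integrable_on {x..y}"
        using ai xy by (auto simp: set_lebesgue_integral_eq_integral)
      \<comment> \<open>The increment of the product is split exactly, with \<open>g\<close> frozen
        at the right end and \<open>f\<close> at the left end. Subtracting \<open>k\<close> then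
        leaves only the small factors \<open>g y - g t\<close> and \<open>f x - f t\<close>.\<close>
      have "((\<lambda>t. g y * f' t + f x * g' t - k t) has_integral
          (g y * (f y - f x) + f x * (g y - g x) - integral {x..y} k)) {x..y}"
        unfolding has_l2_derivD[OF f xy(1-3)] has_l2_derivD[OF g xy(1-3)]
        by (intro has_integral_diff has_integral_add has_integral_mult_right integrable_integral I)
      moreover have "g y * (f y - f x) + f x * (g y - g x) - integral {x..y} k = h y - h x"
        using comb(1)[OF xy(1-3)] by (simp add: h_def algebra_simps)
      ultimately have 1: "((\<lambda>t. g y * f' t + f x * g' t - k t) has_integral (h y - h x)) {x..y}"
        by simp
      have "\<bar>h y - h x\<bar> \<le> integral {x..y} (\<lambda>t. \<epsilon> * e t)"
        unfolding real_norm_def[symmetric] integral_unique[OF 1, symmetric]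
      proof (rule integral_norm_bound_integral)
        show "(\<lambda>t. g y * f' t + f x * g' t - k t) integrable_on {x..y}" using 1 by blast
        show "(\<lambda>t. \<epsilon> * e t) integrable_on {x..y}"
          using ai xy by (intro integrable_on_mult_right) auto
        fix t assume t: "t \<in> {x..y}"
        have "\<bar>g y - g t\<bar> \<le> \<epsilon>" "\<bar>f x - f t\<bar> \<le> \<epsilon>"
          using d1(2)[of x t] d2(2)[of y t] t xy d by auto
        then have "\<bar>(g y - g t) * f' t\<bar> \<le> \<epsilon> * \<bar>f' t\<bar>" "\<bar>(f x - f t) * g' t\<bar> \<le> \<epsilon> * \<bar>g' t\<bar>"
          by (auto simp: abs_mult intro: mult_right_mono)
        moreover have "g y * f' t + f x * g' t - k t = (g y - g t) * f' t + (f x - f t) * g' t"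
          by (simp add: k_def algebra_simps)
        ultimately show "norm (g y * f' t + f x * g' t - k t) \<le> \<epsilon> * e t"
          by (simp add: e_def distrib_left)
      qed
      also have "\<dots> = \<epsilon> * H y - \<epsilon> * H x"
        using comb(2)[OF xy(1-3)] by (simp add: algebra_simps)
      finally show ?thesis .
    qed
    moreover have "d > 0" using d1 d2 by (auto simp: d_def)
    ultimately have "\<bar>h x - h 0\<bar> \<le> \<epsilon> * H x - \<epsilon> * H 0"
      using x by (intro increments_le_of_local[where H = "\<lambda>x. \<epsilon> * H x"]) auto
    then show ?thesis by (simp add: H_def)
  qed
  have "f x * g x = f 0 * g 0 + integral {0..x} k" if x: "x \<in> {0..1}" for x
  proof -
    \<comment> \<open>\<open>H x\<close> does not depend on \<open>\<epsilon>\<close>, so the bound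
      tends to 0 as \<open>\<epsilon>\<close> does.\<close>
    have "((\<lambda>\<epsilon>. \<epsilon> * H x) \<longlongrightarrow> 0 * H x) (at_right 0)"
      by (intro tendsto_intros)
    moreover have "eventually (\<lambda>\<epsilon>. \<bar>h x - h 0\<bar> \<le> \<epsilon> * H x) (at_right 0)"
      using \<open>\<And>x \<epsilon>. \<lbrakk>x \<in> {0..1}; \<epsilon> > 0\<rbrakk> \<Longrightarrow> \<bar>h x - h 0\<bar> \<le> \<epsilon> * H x\<close>[OF x]
      by (auto simp: eventually_at_filter)
    ultimately have "\<bar>h x - h 0\<bar> \<le> 0 * H x"
      by (intro tendsto_lowerbound) auto
    then show ?thesis by (simp add: h_def)
  qed
  with k show ?thesis unfolding has_l2_deriv_iff k_def by blast
qed

section \<open>Uniqueness of the weak derivative up to null sets\<close>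

text \<open>Dynkin's argument: closed half-lines are stable under intersection and generate the
  Borel sets, so the integral of \<open>d\<close> vanishes over every Borel set. The hypothesis
  \<open>tot\<close> serves the passage to complements, since the whole line is not a
  half-line.\<close>

lemma integrable_zero_integrals_AE_zero:
  fixes d :: "real \<Rightarrow> real"
  assumes int: "integrable lborel d"
    and zero: "\<And>x. (LINT t:{..x}|lborel. d t) = 0" and tot: "(LINT t|lborel. d t) = 0"
  shows "AE x in lborel. d x = 0"
proof -
  have si: "set_integrable lborel A d" if "A \<in> sets lborel" for A
    unfolding set_integrable_def by (rule integrable_mult_indicator[OF that int])
  have "(LINT t:A|lborel. d t) = (LINT t:A|lborel. 0)" if "A \<in> sets lborel" for A
  proof -
    have "Int_stable (range (atMost :: real \<Rightarrow> real set))"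
      by (auto simp: Int_stable_def)
    moreover have "range (atMost :: real \<Rightarrow> real set) \<subseteq> Pow UNIV" by simp
    moreover have "A \<in> sigma_sets UNIV (range atMost)"
      using that by (simp add: borel_eq_atMost)
    ultimately have "(LINT t:A|lborel. d t) = 0"
    proof (induction rule: sigma_sets_induct_disjoint)
      case (compl A)
      have A: "A \<in> sets lborel" using compl(1) by (simp add: borel_eq_atMost)
      have "(LINT t:A \<union> (UNIV - A)|lborel. d t) = (LINT t:A|lborel. d t) + (LINT t:UNIV - A|lborel. d t)"
        by (intro set_integral_Un si) (use A in auto)
      then show ?case using compl tot by (simp add: set_lebesgue_integral_def)
    next
      case (union A)
      have A: "A i \<in> sets lborel" for i using union(2) by (auto simp: borel_eq_atMost)
      have "(LINT t:(\<Union>i. A i)|lborel. d t) = (\<Sum>i. (LINT t:A i|lborel. d t))"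
        by (intro lebesgue_integral_countable_add si)
          (use A union(1) in \<open>auto simp: disjoint_family_on_def\<close>)
      then show ?case using union(3) by simp
    qed (use zero in \<open>auto simp: set_lebesgue_integral_def\<close>)
    then show ?thesis by (simp add: set_lebesgue_integral_def)
  qed
  then show ?thesis
    by (intro density_unique_real[OF int]) auto
qed

lemma has_l2_deriv_unique:
  assumes f: "has_l2_deriv f g1" and g: "has_l2_deriv f g2"
  shows "AE x in unit_interval_measure. g1 x = g2 x"
proof -
  \<comment> \<open>Extension by zero turns initial segments of the unit interval into traces of
    half-lines.\<close>
  define d where "d = (\<lambda>x. indicator {0..1} x * (g1 x - g2 x))"
  have ai: "g1 absolutely_integrable_on {0..1}" "g2 absolutely_integrable_on {0..1}"
    using has_l2_derivD(1)[OF f, of 0 1] has_l2_derivD(1)[OF g, of 0 1] by simp_all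
  then have ai2: "(\<lambda>x. g1 x - g2 x) absolutely_integrable_on {0..1}"
    by (rule set_integral_diff(1))
  then have id: "integrable lebesgue d"
    by (simp add: set_integrable_def d_def)
  have dm: "d \<in> borel_measurable lebesgue"
    using id by (rule borel_measurable_integrable)
  \<comment> \<open>Dynkin's argument runs over Borel sets, but \<open>d\<close> is only Lebesgue
    measurable; hence a Borel representative.\<close>
  then obtain d' where d': "d' \<in> borel_measurable lborel" "AE x in lborel. d x = d' x"
    using completion_ex_borel_measurable_real by blast
  have d'2: "AE x in lebesgue. d x = d' x"
    using d'(2) by (rule AE_completion)
  have "integrable lebesgue d'"
    using id d'2 d'(1) by (subst integrable_cong_AE[of _ _ d]) (auto intro: measurable_completion)
  then have id': "integrable lborel d'"
    using d'(1) by (simp add: integrable_completion)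
  have z: "integral {0..x} (\<lambda>x. g1 x - g2 x) = 0" if "x \<in> {0..1}" for x
  proof -
    have "g1 integrable_on {0..x}" "g2 integrable_on {0..x}"
      using has_l2_derivD(1)[OF f, of 0 x] has_l2_derivD(1)[OF g, of 0 x] that
      by (simp_all add: set_lebesgue_integral_eq_integral)
    moreover have "integral {0..x} g1 = integral {0..x} g2"
      using has_l2_derivD(2)[OF f, of 0 x] has_l2_derivD(2)[OF g, of 0 x] that by simp
    ultimately show ?thesis by (simp add: Henstock_Kurzweil_Integration.integral_diff)
  qed
  \<comment> \<open>The two alternatives cover the half-lines ending left of 0, the remaining
    half-lines, and, with \<open>x = 1\<close>, the whole line.\<close>
  have sz: "(LINT t:A|lborel. d' t) = 0" if "A \<inter> {0..1} = {} \<or> A \<inter> {0..1} = {0..min x 1} \<and> 0 \<le> x" "A \<in> sets borel" for A x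
  proof -
    have "(LINT t:A|lborel. d' t) = (LINT t:A|lebesgue. d' t)"
      using that d'(1) unfolding set_lebesgue_integral_def
      by (subst integral_completion) auto
    also have "\<dots> = (LINT t:A|lebesgue. d t)"
      unfolding set_lebesgue_integral_def using d'2 d'(1) dm that
      by (intro Bochner_Integration.integral_cong_AE)
         (auto intro!: borel_measurable_times borel_measurable_indicator intro: measurable_completion)
    also have "\<dots> = (LINT t:A \<inter> {0..1}|lebesgue. g1 t - g2 t)"
      unfolding set_lebesgue_integral_def d_def
      by (intro Bochner_Integration.integral_cong) (auto simp: indicator_def)
    also have "\<dots> = 0"
    proof (cases "A \<inter> {0..1} = {}")
      case False
      then have *: "A \<inter> {0..1} = {0..min x 1}" "0 \<le> x" using that by auto
      have "(LINT t:{0..min x 1}|lebesgue. g1 t - g2 t) = integral {0..min x 1} (\<lambda>x. g1 x - g2 x)"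
        by (rule set_lebesgue_integral_eq_integral(2), rule set_integrable_subset[OF ai2]) auto
      with * z[of "min x 1"] show ?thesis by simp
    qed (simp add: set_lebesgue_integral_def)
    finally show ?thesis .
  qed
  have "AE x in lborel. d' x = 0"
  proof (rule integrable_zero_integrals_AE_zero[OF id'])
    show "(LINT t:{..x}|lborel. d' t) = 0" for x by (rule sz[where x = x]) auto
    show "(LINT t|lborel. d' t) = 0"
      using sz[of UNIV 1] by (simp add: set_lebesgue_integral_def)
  qed
  then have "AE x in lebesgue. d x = 0"
    using AE_completion d'2 by fastforce
  then show ?thesis
    by (subst AE_restrict_space_iff) (auto simp: d_def elim!: eventually_mono)
qed

lemma wderiv_AE:
  assumes "has_l2_deriv f g"
  shows "AE x in unit_interval_measure. wderiv f x = g x"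
  using assms H1_wderiv[of f] by (intro has_l2_deriv_unique[of f]) (auto simp: H1_def)

subsection \<open>Simplicity of eigenvalues\<close>

lemma D_works:
  assumes "f differentiable_on {0..1}" "x \<in> {0..1}"
  shows "(f has_vector_derivative D f x) (at x within {0..1})"
  using assms unfolding D_def differentiable_on_def
  by (simp add: vector_derivative_works)

lemma D_eqI:
  assumes "(f has_vector_derivative f') (at x within {0..1})" "x \<in> {0..1}"
  shows "D f x = f'"
  unfolding D_def by (rule vector_derivative_within_closed_interval) (use assms in auto)

lemma differentiable_on_unitI:
  fixes f :: "real \<Rightarrow> real"
  assumes "\<And>x. x \<in> {0..1} \<Longrightarrow> (f has_vector_derivative f' x) (at x within {0..1})"
  shows "f differentiable_on {0..1}"
  using assms unfolding differentiable_on_def by (blast intro: differentiableI_vector)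

lemma D_cong_scaled:
  assumes "f differentiable_on {0..1}" "\<And>x. x \<in> {0..1} \<Longrightarrow> g x = c * f x" "x \<in> {0..1}"
  shows "D g x = c * D f x"
proof -
  have "((\<lambda>x. c * f x) has_vector_derivative c * D f x) (at x within {0..1})"
    by (intro has_vector_derivative_mult_right D_works assms)
  then have "(g has_vector_derivative c * D f x) (at x within {0..1})"
    by (rule has_vector_derivative_transform[rotated 2]) (use assms in auto)
  then show ?thesis by (rule D_eqI) fact
qed

lemma has_l2_deriv_D:
  assumes "f differentiable_on {0..1}" "D f \<in> H1"
  shows "has_l2_deriv f (D f)"
  using assms by (intro has_l2_deriv_C1 D_works has_l2_deriv_continuous[OF H1_wderiv])

text \<open>The measure lives on the open interval and the integrals on the closed one; the two end
  points join the exceptional set. Negligibility is the form that spike lemmas for the gauge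
  integral accept.\<close>

lemma AE_unit_negligible:
  assumes "AE x in unit_interval_measure. P x"
  obtains N where "negligible N" "\<And>x. x \<in> {0..1} - N \<Longrightarrow> P x"
proof -
  have "AE x in lebesgue. x \<in> {0<..<1} \<longrightarrow> P x"
    using assms by (subst (asm) AE_restrict_space_iff) auto
  then obtain N where N: "\<And>x. x \<notin> N \<Longrightarrow> x \<in> {0<..<1} \<longrightarrow> P x" "N \<in> null_sets lebesgue"
    by (rule AE_E3) auto
  have "negligible (N \<union> {0, 1})"
    using N(2) by (auto simp: negligible_iff_null_sets[symmetric])
  then show thesis
    by (rule that) (use N(1) in force)
qed

text \<open>On an interval where \<open>1 + \<bar>r\<bar>\<close> has integral below \<open>1/2\<close>, the maximum of \<open>\<bar>y\<bar> + \<bar>y'\<bar>\<close> is at most half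
  of itself once \<open>y\<close> and \<open>y'\<close> vanish at its left end; the unit interval is covered by finitely many.\<close>

lemma zero_initial_data_imp_zero:
  assumes y: "y differentiable_on {0..1}" and g: "has_l2_deriv (D y) g"
    and eq: "AE x in unit_interval_measure. g x = r x * y x"
    and r: "r absolutely_integrable_on {0..1}"
    and zero: "y 0 = 0" "D y 0 = 0" and x: "x \<in> {0..1}"
  shows "y x = 0"
proof -
  have y': "has_l2_deriv y (D y)"
    using has_l2_deriv_D[OF y] g by (auto simp: H1_def)
  obtain N where N: "negligible N" "\<And>x. x \<in> {0..1} - N \<Longrightarrow> g x = r x * y x"
    using AE_unit_negligible[OF eq] by blast
  \<comment> \<open>The equation is read as a first-order system for the pair
    \<open>(y, D y)\<close>: \<open>E\<close> is its norm, and \<open>k\<close> bounds the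
    coefficients, 1 coming from the first component and \<open>\<bar>r\<bar>\<close> from the
    second.\<close>
  define E where "E = (\<lambda>x. \<bar>y x\<bar> + \<bar>D y x\<bar>)"
  define k where "k = (\<lambda>x. 1 + \<bar>r x\<bar>)"
  define H where "H = (\<lambda>x. integral {0..x} k)"
  have ri: "(\<lambda>x. \<bar>r x\<bar>) integrable_on {s..t}" if "0 \<le> s" "t \<le> 1" for s t
  proof -
    have "r absolutely_integrable_on {s..t}"
      by (rule set_integrable_subset[OF r]) (use that in auto)
    then show ?thesis by (simp add: absolutely_integrable_on_def)
  qed
  have ki: "k integrable_on {s..t}" if "0 \<le> s" "t \<le> 1" for s t
    unfolding k_def using ri that by (intro integrable_add) auto
  have growth: "E t \<le> S * (H t - H s)"
    if st: "0 \<le> s" "s \<le> t" "t \<le> 1" and E0: "E s = 0"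
      and S: "\<And>\<tau>. \<tau> \<in> {s..t} \<Longrightarrow> E \<tau> \<le> S" for s t S
  proof -
    have sub: "{s..t} \<subseteq> {0..1}" using st by auto
    have "D y integrable_on {s..t}" "g integrable_on {s..t}"
      using has_l2_derivD(1)[OF y' st] has_l2_derivD(1)[OF g st]
      by (simp_all add: set_lebesgue_integral_eq_integral)
    note i = this
    have "norm (integral {s..t} (D y)) \<le> integral {s..t} (\<lambda>\<tau>. S * 1)"
    proof (rule integral_norm_bound_integral)
      show "norm (D y \<tau>) \<le> S * 1" if "\<tau> \<in> {s..t}" for \<tau>
        using S[OF that] by (simp add: E_def)
    qed (use i in auto)
    moreover have "y t = integral {s..t} (D y)" "D y t = integral {s..t} g"
      using has_l2_derivD(2)[OF y' st] has_l2_derivD(2)[OF g st] E0 by (auto simp: E_def)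
    moreover have "\<bar>integral {s..t} g\<bar> \<le> integral {s..t} (\<lambda>\<tau>. S * \<bar>r \<tau>\<bar>)"
    proof -
      \<comment> \<open>Zeroing \<open>g\<close> on the exceptional set keeps the integral and makes
        the bound hold at every point; there it needs \<open>0 \<le> S\<close>.\<close>
      define g' where "g' = (\<lambda>\<tau>. if \<tau> \<in> N then 0 else g \<tau>)"
      have "integral {s..t} g = integral {s..t} g'"
        by (rule integral_spike[OF N(1)]) (auto simp: g'_def)
      moreover have "norm (integral {s..t} g') \<le> integral {s..t} (\<lambda>\<tau>. S * \<bar>r \<tau>\<bar>)"
      proof (rule integral_norm_bound_integral)
        show "g' integrable_on {s..t}"
          by (rule integrable_spike[OF i(2) N(1)]) (auto simp: g'_def)
        show "(\<lambda>\<tau>. S * \<bar>r \<tau>\<bar>) integrable_on {s..t}"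
          by (intro integrable_on_mult_right ri st)
        fix \<tau> assume \<tau>: "\<tau> \<in> {s..t}"
        then have "\<bar>y \<tau>\<bar> \<le> S" using S[OF \<tau>] by (auto simp: E_def)
        moreover from this have "0 \<le> S" by linarith
        ultimately show "norm (g' \<tau>) \<le> S * \<bar>r \<tau>\<bar>"
          using N(2)[of \<tau>] \<tau> sub
          by (auto simp: g'_def abs_mult mult.commute[of S] intro!: mult_left_mono)
      qed
      ultimately show ?thesis by simp
    qed
    moreover have "integral {s..t} (\<lambda>\<tau>. S * 1) + integral {s..t} (\<lambda>\<tau>. S * \<bar>r \<tau>\<bar>) = S * integral {s..t} k"
      unfolding k_def using ri[OF st(1,3)]
      by (subst Henstock_Kurzweil_Integration.integral_add) (auto simp: algebra_simps)
    moreover have "integral {s..t} k = H t - H s"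
      using Henstock_Kurzweil_Integration.integral_combine[of 0 s t k] st ki[of 0 t]
      by (simp add: H_def)
    ultimately show ?thesis by (simp add: E_def)
  qed
  have "continuous_on {0..1} H"
    unfolding H_def by (intro indefinite_integral_continuous_1 ki) auto
  then obtain d where d: "d > 0"
    "\<And>s t. \<lbrakk>s \<in> {0..1}; t \<in> {0..1}; \<bar>t - s\<bar> < d\<rbrakk> \<Longrightarrow> \<bar>H t - H s\<bar> < 1/2"
    using compact_uniformly_continuous[OF _ compact_Icc, of 0 1 H]
    unfolding uniformly_continuous_on_def dist_real_def by (metis half_gt_zero_iff zero_less_one)
  define \<delta> where "\<delta> = d / 2"
  have \<delta>: "0 < \<delta>" "\<delta> < d" using d by (auto simp: \<delta>_def)
  have cE: "continuous_on {0..1} E"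
    unfolding E_def by (intro continuous_intros has_l2_deriv_continuous[OF y'] has_l2_deriv_continuous[OF g])
  have "\<forall>x\<in>{0..1}. x \<le> real n * \<delta> \<longrightarrow> E x = 0" for n
  proof (induction n)
    case 0
    then show ?case using zero by (auto simp: E_def)
  next
    case (Suc n)
    show ?case
    proof (intro ballI impI)
      fix x :: real assume x: "x \<in> {0..1}" "x \<le> real (Suc n) * \<delta>"
      \<comment> \<open>The right end of the stretch already settled by the induction hypothesis;
        \<open>E\<close> vanishes there and serves as new initial data.\<close>
      define s where "s = real n * \<delta>"
      show "E x = 0"
      proof (cases "x \<le> s")
        case True
        then show ?thesis using Suc x by (auto simp: s_def)
      next
        case False
        then have s: "s \<in> {0..1}" "s \<le> x" "E s = 0"
          using Suc x \<delta> by (auto simp: s_def)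
        have "continuous_on {s..x} E"
          by (rule continuous_on_subset[OF cE]) (use s x in auto)
        then have "\<exists>m\<in>{s..x}. \<forall>\<tau>\<in>{s..x}. E \<tau> \<le> E m"
          using s by (intro continuous_attains_sup) simp_all
        then obtain m where m: "m \<in> {s..x}" "\<And>\<tau>. \<tau> \<in> {s..x} \<Longrightarrow> E \<tau> \<le> E m"
          by blast
        \<comment> \<open>The growth bound is applied at the maximum point itself, with the maximum
          as \<open>S\<close>.\<close>
        have "E m \<le> E m * (H m - H s)"
          by (rule growth) (use s x m in auto)
        moreover have "H m - H s < 1/2"
        proof -
          have "m - s \<le> \<delta>" using m x by (simp add: s_def algebra_simps)
          then have "\<bar>H m - H s\<bar> < 1/2"
            using \<delta> m s x by (intro d(2)) auto
          then show ?thesis by linarith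
        qed
        moreover have "E m \<ge> 0" by (simp add: E_def)
        ultimately have "E m \<le> E m * (1/2)"
          by (meson less_imp_le mult_left_mono order_trans)
        then have "E m \<le> 0" by simp
        then have "E x \<le> 0" using m s by (meson atLeastAtMost_iff order_refl order_trans)
        then show ?thesis by (simp add: E_def)
      qed
    qed
  qed
  moreover obtain n where "x / \<delta> \<le> real n"
    using real_arch_simple by blast
  then have "x \<le> real n * \<delta>"
    using \<delta> by (simp add: field_simps)
  ultimately have "E x = 0" using x by blast
  then show ?thesis by (simp add: E_def)
qed

text \<open>By linearity the combination solves the same equation, with coefficient
  \<open>p - \<mu>\<close>, and it starts from zero initial data.\<close>

lemma schroedinger_lincomb_zero:
  assumes p: "p absolutely_integrable_on {0..1}"
    and y: "eigenfunction unit_interval_measure (schroedinger p a b) \<mu> y"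
    and z: "eigenfunction unit_interval_measure (schroedinger p a b) \<mu> z"
    and zero: "c * y 0 + d * z 0 = 0" "c * D y 0 + d * D z 0 = 0" and x: "x \<in> {0..1}"
  shows "c * y x + d * z x = 0"
proof -
  define w where "w = (\<lambda>x. c * y x + d * z x)"
  have yz: "y differentiable_on {0..1}" "z differentiable_on {0..1}" "D y \<in> H1" "D z \<in> H1"
    "AE x in unit_interval_measure. - wderiv (D y) x + p x * y x = \<mu> * y x"
    "AE x in unit_interval_measure. - wderiv (D z) x + p x * z x = \<mu> * z x"
    using y z by (auto simp: eigenfunction_def schroedinger_def)
  have w': "(w has_vector_derivative c * D y x + d * D z x) (at x within {0..1})"
    if "x \<in> {0..1}" for x
    unfolding w_def
    by (intro has_vector_derivative_add has_vector_derivative_mult_right D_works yz that)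
  have wd: "w differentiable_on {0..1}"
    by (rule differentiable_on_unitI[OF w'])
  have "has_l2_deriv (D w) (\<lambda>x. c * wderiv (D y) x + d * wderiv (D z) x)"
    using has_l2_deriv_lincomb[OF H1_wderiv[OF yz(3)] H1_wderiv[OF yz(4)], of c d]
    by (rule has_l2_deriv_cong[THEN iffD1, rotated]) (simp add: D_eqI[OF w'])
  moreover have "AE x in unit_interval_measure.
      c * wderiv (D y) x + d * wderiv (D z) x = (p x - \<mu>) * w x"
    using yz(5,6)
  proof eventually_elim
    case (elim x)
    then have eq: "wderiv (D y) x = (p x - \<mu>) * y x" "wderiv (D z) x = (p x - \<mu>) * z x"
      by (auto simp: algebra_simps)
    show ?case unfolding eq by (simp add: w_def algebra_simps)
  qed
  moreover have "(\<lambda>x. p x - \<mu>) absolutely_integrable_on {0..1}"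
    by (intro set_integral_diff(1) p absolutely_integrable_on_const) auto
  moreover have "w 0 = 0" "D w 0 = 0"
    using zero D_eqI[OF w', of 0] by (simp_all add: w_def)
  ultimately have "w x = 0"
    by (rule zero_initial_data_imp_zero[OF wd]) (rule x)
  then show ?thesis by (simp add: w_def)
qed

text \<open>The boundary condition at 0 confines the initial data of \<open>y\<close> and
  \<open>z\<close> to a common line in the plane, so some combination cancels both components.
  Nonzero initial data make its coefficients, and hence \<open>c\<close>, nonzero.\<close>

lemma schroedinger_eigenfunctions_proportional:
  assumes p: "p absolutely_integrable_on {0..1}"
    and y: "eigenfunction unit_interval_measure (schroedinger p a b) \<mu> y"
    and z: "eigenfunction unit_interval_measure (schroedinger p a b) \<mu> z"
  obtains c where "c \<noteq> 0" "\<And>x. x \<in> {0..1} \<Longrightarrow> z x = c * y x"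
proof -
  have nonzero: "v 0 \<noteq> 0 \<or> D v 0 \<noteq> 0"
    if v: "eigenfunction unit_interval_measure (schroedinger p a b) \<mu> v" for v
  proof (rule ccontr)
    assume "\<not> ?thesis"
    then have "v x = 0" if "x \<in> {0..1}" for x
      using schroedinger_lincomb_zero[OF p v v, of 1 0 x] that by simp
    then have "AE x in unit_interval_measure. v x = 0"
      by (intro AE_I2) simp
    with v show False by (simp add: eigenfunction_def)
  qed
  have bc: "bc a b y" "bc a b z"
    using y z by (auto simp: eigenfunction_def schroedinger_def)
  show thesis
  proof (cases a)
    case Infinite
    then have "y 0 = 0" "z 0 = 0" using bc by (auto simp: bc_def)
    with nonzero[OF y] nonzero[OF z] have "D y 0 \<noteq> 0" "D z 0 \<noteq> 0" by auto
    moreover have "D z 0 * y x - D y 0 * z x = 0" if "x \<in> {0..1}" for x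
      using schroedinger_lincomb_zero[OF p y z, of "D z 0" "- D y 0" x] that \<open>y 0 = 0\<close> \<open>z 0 = 0\<close>
      by simp
    ultimately show thesis
      by (intro that[of "D z 0 / D y 0"]) (auto simp: field_simps)
  next
    case (Fin \<alpha>)
    then have D: "D y 0 = \<alpha> * y 0" "D z 0 = \<alpha> * z 0" using bc by (auto simp: bc_def)
    with nonzero[OF y] nonzero[OF z] have "y 0 \<noteq> 0" "z 0 \<noteq> 0" by auto
    moreover have "z 0 * y x - y 0 * z x = 0" if "x \<in> {0..1}" for x
      using schroedinger_lincomb_zero[OF p y z, of "z 0" "- y 0" x] that D
      by simp
    ultimately show thesis
      by (intro that[of "z 0 / y 0"]) (auto simp: field_simps)
  qed
qed

subsection \<open>The gauge transformation\<close>

lemma W10_has_l2_deriv: "q \<in> W10 \<Longrightarrow> has_l2_deriv q (wderiv q)"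
  unfolding W10_def by (blast intro: H1_wderiv)

lemma W10_zero: "q \<in> W10 \<Longrightarrow> q 0 = 0" "q \<in> W10 \<Longrightarrow> q 1 = 0"
  by (auto simp: W10_def)

lemma primitive_has_vector_derivative:
  assumes q: "continuous_on {0..1} q" and x: "x \<in> {0..1}"
  shows "(primitive q has_vector_derivative q x) (at x within {0..1})"
proof -
  have eq: "primitive q t = integral {0..t} q" if "t \<in> {0..1}" for t
    unfolding primitive_def using that lspace_continuous[OF q] by (intro lspace_integral) auto
  have "((\<lambda>t. integral {0..t} q) has_vector_derivative q x) (at x within {0..1})"
    by (rule integral_has_vector_derivative[OF q x])
  then show ?thesis
    by (rule has_vector_derivative_transform[OF x, rotated]) (rule eq)
qed

lemma rho_nonzero [simp]: "rho q x \<noteq> 0"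
  by (simp add: rho_def)

text \<open>This normalization is why the norming constants contain \<open>rho q 1\<close> but no
  factor from the left end.\<close>

lemma rho_0 [simp]: "rho q 0 = 1"
proof -
  have "primitive q 0 = 0"
    unfolding primitive_def set_lebesgue_integral_def
    by (rule integral_eq_zero_AE)
      (use AE_completion[OF AE_lborel_singleton[of 0]] in \<open>auto elim!: eventually_mono\<close>)
  then show ?thesis by (simp add: rho_def)
qed

lemma rho_has_vector_derivative:
  assumes "continuous_on {0..1} q" "x \<in> {0..1}"
  shows "(rho q has_vector_derivative rho q x * q x) (at x within {0..1})"
  using primitive_has_vector_derivative[OF assms] unfolding rho_def has_real_derivative_iff_has_vector_derivative[symmetric]
  by (auto intro!: derivative_eq_intros)

lemma rho_continuous:
  assumes "continuous_on {0..1} q" shows "continuous_on {0..1} (rho q)"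
  using rho_has_vector_derivative[OF assms]
  by (intro continuous_on_vector_derivative) auto

lemma rho_has_l2_deriv:
  assumes "continuous_on {0..1} q"
  shows "has_l2_deriv (rho q) (\<lambda>x. rho q x * q x)"
  by (intro has_l2_deriv_C1 rho_has_vector_derivative continuous_intros rho_continuous assms)

lemma inverse_rho_has_l2_deriv:
  assumes "continuous_on {0..1} q"
  shows "has_l2_deriv (\<lambda>x. 1 / rho q x) (\<lambda>x. - q x / rho q x)"
proof (rule has_l2_deriv_C1)
  fix x :: real assume "x \<in> {0..1}"
  from rho_has_vector_derivative[OF assms this]
  show "((\<lambda>x. 1 / rho q x) has_vector_derivative - q x / rho q x) (at x within {0..1})"
    unfolding has_real_derivative_iff_has_vector_derivative[symmetric]
    by (auto intro!: derivative_eq_intros)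
qed (intro continuous_intros rho_continuous assms ballI rho_nonzero)

lemma gauge_has_vector_derivative:
  assumes "continuous_on {0..1} q" "y differentiable_on {0..1}" "x \<in> {0..1}"
  shows "((\<lambda>x. y x / rho q x) has_vector_derivative (D y x - q x * y x) / rho q x) (at x within {0..1})"
  using rho_has_vector_derivative[OF assms(1,3)] D_works[OF assms(2,3)]
  unfolding has_real_derivative_iff_has_vector_derivative[symmetric]
  by (auto intro!: derivative_eq_intros simp: field_simps)

lemma inverse_gauge_has_vector_derivative:
  assumes "continuous_on {0..1} q" "f differentiable_on {0..1}" "x \<in> {0..1}"
  shows "((\<lambda>x. rho q x * f x) has_vector_derivative rho q x * (D f x + q x * f x)) (at x within {0..1})"
  using rho_has_vector_derivative[OF assms(1,3)] D_works[OF assms(2,3)]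
  unfolding has_real_derivative_iff_has_vector_derivative[symmetric]
  by (auto intro!: derivative_eq_intros simp: field_simps)

text \<open>The gauge transformation preserves both boundary conditions because \<open>q\<close> vanishes at the end
  points, so that there \<open>f' = y' / rho\<close>.\<close>

lemma gauge_bc:
  assumes q: "q \<in> W10" and y: "y differentiable_on {0..1}"
  shows "bc a b (\<lambda>x. y x / rho q x) \<longleftrightarrow> bc a b y"
proof -
  have c: "continuous_on {0..1} q"
    by (rule has_l2_deriv_continuous[OF W10_has_l2_deriv[OF q]])
  have "D (\<lambda>x. y x / rho q x) 0 = D y 0" "D (\<lambda>x. y x / rho q x) 1 = D y 1 / rho q 1"
    using D_eqI[OF gauge_has_vector_derivative[OF c y], of 0]
      D_eqI[OF gauge_has_vector_derivative[OF c y], of 1] W10_zero[OF q] by auto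
  then show ?thesis
    by (auto simp: bc_def add_divide_distrib[symmetric] split: bparam.split)
qed

text \<open>With \<open>f = y / rho\<close> the quasi-derivative \<open>rho\<^sup>2 f'\<close>
  equals \<open>rho (y' - q y)\<close>, built from functions in \<open>H1\<close> by products and
  differences. Differentiating it, the two terms with \<open>q y'\<close> cancel.\<close>

lemma gauge_momentum_has_l2_deriv:
  assumes q: "q \<in> W10" and y: "y differentiable_on {0..1}" "D y \<in> H1"
  shows "has_l2_deriv (\<lambda>x. (rho q x)\<^sup>2 * D (\<lambda>x. y x / rho q x) x)
    (\<lambda>x. rho q x * (wderiv (D y) x - (wderiv q x + (q x)\<^sup>2) * y x))"
proof -
  have c: "continuous_on {0..1} q"
    by (rule has_l2_deriv_continuous[OF W10_has_l2_deriv[OF q]])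
  have "has_l2_deriv (\<lambda>x. D y x - q x * y x)
      (\<lambda>x. wderiv (D y) x - (wderiv q x * y x + q x * D y x))"
    using has_l2_deriv_lincomb[OF H1_wderiv[OF y(2)]
        has_l2_deriv_mult[OF W10_has_l2_deriv[OF q] has_l2_deriv_D[OF y]], of 1 "-1"]
    by (simp add: algebra_simps)
  from has_l2_deriv_mult[OF rho_has_l2_deriv[OF c] this]
  have "has_l2_deriv (\<lambda>x. rho q x * (D y x - q x * y x))
    (\<lambda>x. rho q x * (wderiv (D y) x - (wderiv q x + (q x)\<^sup>2) * y x))"
    by (rule back_subst[of "has_l2_deriv _"]) (auto simp: algebra_simps power2_eq_square)
  then show ?thesis
    by (rule has_l2_deriv_cong[THEN iffD1, rotated])
      (simp add: D_eqI[OF gauge_has_vector_derivative[OF c y(1)]] power2_eq_square)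
qed

lemma gauge_domain:
  assumes q: "q \<in> W10"
  shows "(\<lambda>x. y x / rho q x) \<in> fst (neg_laplacian q u a b) \<longleftrightarrow> y \<in> fst (schroedinger p a b)"
proof
  have c: "continuous_on {0..1} q"
    by (rule has_l2_deriv_continuous[OF W10_has_l2_deriv[OF q]])
  {
    assume "y \<in> fst (schroedinger p a b)"
    then have y: "y differentiable_on {0..1}" "D y \<in> H1" "bc a b y"
      by (auto simp: schroedinger_def)
    show "(\<lambda>x. y x / rho q x) \<in> fst (neg_laplacian q u a b)"
      using differentiable_on_unitI[OF gauge_has_vector_derivative[OF c y(1)]]
        gauge_momentum_has_l2_deriv[OF q y(1,2)] gauge_bc[OF q y(1)] y(3)
      unfolding neg_laplacian_def H1_def by auto
  next
    assume *: "(\<lambda>x. y x / rho q x) \<in> fst (neg_laplacian q u a b)"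
    define f where "f = (\<lambda>x. y x / rho q x)"
    have y_eq: "y = (\<lambda>x. rho q x * f x)" by (simp add: f_def)
    from * have f: "f differentiable_on {0..1}" "(\<lambda>x. (rho q x)\<^sup>2 * D f x) \<in> H1" "bc a b f"
      by (auto simp: neg_laplacian_def f_def)
    note y' = inverse_gauge_has_vector_derivative[OF c f(1), folded y_eq]
    have y: "y differentiable_on {0..1}"
      by (rule differentiable_on_unitI[OF y'])
    \<comment> \<open>This product is \<open>rho f'\<close>; dividing once more by
      \<open>rho\<close> shows that \<open>f'\<close> is continuous, so that \<open>f\<close> itself
      lies in \<open>H1\<close>.\<close>
    note mom = has_l2_deriv_mult[OF inverse_rho_has_l2_deriv[OF c] H1_wderiv[OF f(2)]]
    have "continuous_on {0..1} (\<lambda>x. 1 / rho q x * ((rho q x)\<^sup>2 * D f x) / rho q x)"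
      by (intro continuous_intros has_l2_deriv_continuous[OF mom] rho_continuous c ballI rho_nonzero)
    then have "continuous_on {0..1} (D f)"
      by (simp add: power2_eq_square)
    then have "has_l2_deriv f (D f)"
      by (intro has_l2_deriv_C1 D_works f(1))
    note qf = has_l2_deriv_mult[OF has_l2_deriv_mult[OF rho_has_l2_deriv[OF c] W10_has_l2_deriv[OF q]] this]
    \<comment> \<open>Here \<open>y' = (rho q) f + (1 / rho) (rho\<^sup>2 f')\<close>, where
      \<open>f'\<close> enters only through the quasi-derivative.\<close>
    have "D y \<in> H1"
      using has_l2_deriv_lincomb[OF qf mom, of 1 1]
      by (subst H1_cong(1)[where f' = "\<lambda>x. 1 * (rho q x * q x * f x) + 1 * (1 / rho q x * ((rho q x)\<^sup>2 * D f x))"])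
        (auto simp: D_eqI[OF y'] H1_def power2_eq_square algebra_simps)
    moreover have "bc a b y"
      using gauge_bc[OF q y, of a b] f(3) by (simp add: f_def)
    ultimately show "y \<in> fst (schroedinger p a b)"
      using y by (simp add: schroedinger_def)
  }
qed

text \<open>Dividing the derivative of the quasi-derivative by \<open>- rho\<^sup>2\<close> leaves
  \<open>(- y'' + (q' + q\<^sup>2 + u) y) / rho\<close>, and the bracketed potential is
  \<open>p + c0\<close>.\<close>

lemma gauge_action:
  assumes q: "q \<in> W10" and y: "y \<in> fst (schroedinger p a b)"
    and p: "p = (\<lambda>x. wderiv q x + (q x)\<^sup>2 + u x - c0)"
  shows "AE x in unit_interval_measure. snd (neg_laplacian q u a b) (\<lambda>x. y x / rho q x) x
    = (snd (schroedinger p a b) y x + c0 * y x) / rho q x"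
proof -
  have "y differentiable_on {0..1}" "D y \<in> H1"
    using y by (auto simp: schroedinger_def)
  from wderiv_AE[OF gauge_momentum_has_l2_deriv[OF q this]] show ?thesis
  proof eventually_elim
    case (elim x)
    show ?case
      unfolding neg_laplacian_def schroedinger_def snd_conv elim p
      by (simp add: field_simps power2_eq_square)
  qed
qed

section \<open>The weighted space and unitarity of division by \<open>rho\<close>\<close>

context
  fixes q :: "real \<Rightarrow> real"
  assumes q: "continuous_on {0..1} q"
begin

lemma rho_measurable [measurable]: "rho q \<in> borel_measurable unit_interval_measure"
  by (intro continuous_on_measurable_unit rho_continuous q)

text \<open>The density is positive everywhere, so both measures have the same null sets.\<close>

lemma AE_weighted_rho:
  "(AE x in weighted (\<lambda>x. (rho q x)\<^sup>2). P x) \<longleftrightarrow> (AE x in unit_interval_measure. P x)"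
  unfolding weighted_def by (subst AE_density) auto

lemma measurable_weighted_rho:
  "f \<in> borel_measurable (weighted (\<lambda>x. (rho q x)\<^sup>2)) \<longleftrightarrow> f \<in> borel_measurable unit_interval_measure"
  by (simp add: weighted_def)

lemma integral_weighted_rho:
  assumes "h \<in> borel_measurable unit_interval_measure"
  shows "(LINT x|weighted (\<lambda>x. (rho q x)\<^sup>2). h x) = (LINT x|unit_interval_measure. (rho q x)\<^sup>2 * h x)"
    "integrable (weighted (\<lambda>x. (rho q x)\<^sup>2)) h \<longleftrightarrow>
      integrable unit_interval_measure (\<lambda>x. (rho q x)\<^sup>2 * h x)"
  unfolding weighted_def using assms by (simp_all add: integral_density integrable_density)

lemma gauge_lspace:
  "(\<lambda>x. f x / rho q x) \<in> lspace (weighted (\<lambda>x. (rho q x)\<^sup>2)) \<longleftrightarrow> f \<in> lspace unit_interval_measure"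
proof -
  have "f \<in> borel_measurable unit_interval_measure"
    if "(\<lambda>x. f x / rho q x) \<in> borel_measurable unit_interval_measure"
    using borel_measurable_times[OF that rho_measurable] by simp
  then have "(\<lambda>x. f x / rho q x) \<in> borel_measurable unit_interval_measure \<longleftrightarrow>
      f \<in> borel_measurable unit_interval_measure"
    using borel_measurable_divide[OF _ rho_measurable] by blast
  then show ?thesis
    by (auto simp: lspace_def measurable_weighted_rho integral_weighted_rho power_divide)
qed

lemma gauge_unitary:
  "unitary_map unit_interval_measure (weighted (\<lambda>x. (rho q x)\<^sup>2)) (\<lambda>f x. f x / rho q x)"
  unfolding unitary_map_def
proof (intro conjI ballI allI)
  fix f g assume "f \<in> lspace unit_interval_measure" "g \<in> lspace unit_interval_measure"
  then have "(\<lambda>x. f x / rho q x * (g x / rho q x)) \<in> borel_measurable unit_interval_measure"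
    by (auto simp: lspace_def)
  from integral_weighted_rho(1)[OF this]
  show "(LINT x|weighted (\<lambda>x. (rho q x)\<^sup>2). f x / rho q x * (g x / rho q x)) =
      (LINT x|unit_interval_measure. f x * g x)"
    by (simp add: power2_eq_square)
next
  fix h assume h: "h \<in> lspace (weighted (\<lambda>x. (rho q x)\<^sup>2))"
  then have "(\<lambda>x. rho q x * h x) \<in> lspace unit_interval_measure"
    using gauge_lspace[of "\<lambda>x. rho q x * h x"] by simp
  then show "\<exists>f\<in>lspace unit_interval_measure.
      AE x in weighted (\<lambda>x. (rho q x)\<^sup>2). f x / rho q x = h x"
    by (intro bexI[of _ "\<lambda>x. rho q x * h x"]) auto
qed (auto simp: gauge_lspace add_divide_distrib)

end

section \<open>Transfer of operator graphs and eigenfunctions\<close>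

lemma gauge_op_graph:
  assumes q: "q \<in> W10" and p: "p = (\<lambda>x. wderiv q x + (q x)\<^sup>2 + u x - c0)"
  shows "((\<lambda>x. f x / rho q x), (\<lambda>x. g x / rho q x))
      \<in> op_graph (weighted (\<lambda>x. (rho q x)\<^sup>2)) (neg_laplacian q u a b) \<longleftrightarrow>
    (f, g) \<in> op_graph unit_interval_measure (add_const (schroedinger p a b) c0)"
proof -
  have c: "continuous_on {0..1} q"
    by (rule has_l2_deriv_continuous[OF W10_has_l2_deriv[OF q]])
  let ?L = "neg_laplacian q u a b" and ?S = "add_const (schroedinger p a b) c0"
  let ?P = "\<lambda>f0. (AE x in unit_interval_measure. f x / rho q x = f0 x) \<and>
    (AE x in unit_interval_measure. g x / rho q x = snd ?L f0 x)"
  have dom: "(\<lambda>x. y x / rho q x) \<in> fst ?L \<longleftrightarrow> y \<in> fst ?S" for y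
    using gauge_domain[OF q] by (simp add: add_const_def)
  have act: "?P (\<lambda>x. y x / rho q x) \<longleftrightarrow>
     (AE x in unit_interval_measure. f x = y x) \<and> (AE x in unit_interval_measure. g x = snd ?S y x)"
    if "y \<in> fst ?S" for y
  proof -
    have "AE x in unit_interval_measure. snd ?L (\<lambda>x. y x / rho q x) x = snd ?S y x / rho q x"
      using gauge_action[OF q _ p, of y a b] that by (simp add: add_const_def)
    then have "(AE x in unit_interval_measure. g x / rho q x = snd ?L (\<lambda>x. y x / rho q x) x) \<longleftrightarrow>
      (AE x in unit_interval_measure. g x = snd ?S y x)"
      by (intro eventually_subst) (auto elim!: eventually_mono)
    then show ?thesis by simp
  qed
  \<comment> \<open>The representatives are reindexed by \<open>f0 = y / rho\<close>, with inverse
    \<open>y = rho f0\<close>, a bijection between the two domains.\<close>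
  have "(\<exists>f0\<in>fst ?L. ?P f0) \<longleftrightarrow> (\<exists>y\<in>fst ?S. ?P (\<lambda>x. y x / rho q x))"
  proof
    assume "\<exists>f0\<in>fst ?L. ?P f0"
    then obtain f0 where f0: "f0 \<in> fst ?L" "?P f0" by blast
    then have "(\<lambda>x. rho q x * f0 x) \<in> fst ?S"
      using dom[of "\<lambda>x. rho q x * f0 x"] by simp
    with f0 show "\<exists>y\<in>fst ?S. ?P (\<lambda>x. y x / rho q x)"
      by (intro bexI[of _ "\<lambda>x. rho q x * f0 x"]) simp_all
  next
    assume "\<exists>y\<in>fst ?S. ?P (\<lambda>x. y x / rho q x)"
    then obtain y where "y \<in> fst ?S" "?P (\<lambda>x. y x / rho q x)" by blast
    then show "\<exists>f0\<in>fst ?L. ?P f0"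
      using dom[of y] by (intro bexI[of _ "\<lambda>x. y x / rho q x"]) simp_all
  qed
  also have "\<dots> \<longleftrightarrow> (\<exists>y\<in>fst ?S. (AE x in unit_interval_measure. f x = y x) \<and>
      (AE x in unit_interval_measure. g x = snd ?S y x))"
    using act by (intro bex_cong refl)
  finally show ?thesis
    unfolding op_graph_def by (simp add: gauge_lspace[OF c] AE_weighted_rho[OF c])
qed

lemma gauge_eigenfunction:
  assumes q: "q \<in> W10" and p: "p = (\<lambda>x. wderiv q x + (q x)\<^sup>2 + u x - c0)"
  shows "eigenfunction (weighted (\<lambda>x. (rho q x)\<^sup>2)) (neg_laplacian q u a b) (\<mu> + c0) (\<lambda>x. y x / rho q x)
    \<longleftrightarrow> eigenfunction unit_interval_measure (schroedinger p a b) \<mu> y"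
proof -
  have c: "continuous_on {0..1} q"
    by (rule has_l2_deriv_continuous[OF W10_has_l2_deriv[OF q]])
  let ?L = "neg_laplacian q u a b" and ?S = "schroedinger p a b"
  have "(AE x in unit_interval_measure. snd ?L (\<lambda>x. y x / rho q x) x = (\<mu> + c0) * (y x / rho q x)) \<longleftrightarrow>
      (AE x in unit_interval_measure. snd ?S y x = \<mu> * y x)" if "y \<in> fst ?S"
  proof (rule eventually_subst)
    from gauge_action[OF q that p]
    show "AE x in unit_interval_measure.
      (snd ?L (\<lambda>x. y x / rho q x) x = (\<mu> + c0) * (y x / rho q x)) = (snd ?S y x = \<mu> * y x)"
      by eventually_elim (auto simp: field_simps)
  qed
  then show ?thesis
    unfolding eigenfunction_def AE_weighted_rho[OF c] gauge_domain[OF q, where p = p]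
    by (cases "y \<in> fst ?S") simp_all
qed

section \<open>Continuity of the potential and counting of eigenvalues\<close>

lemma real_analytic_continuous:
  assumes "real_analytic u" shows "continuous_on A u"
proof (rule continuous_at_imp_continuous_on, rule ballI)
  fix x0 :: real
  from assms obtain c r where r: "r > 0"
    "\<And>x. \<bar>x - x0\<bar> < r \<Longrightarrow> (\<lambda>n. c n * (x - x0) ^ n) sums u x"
    unfolding real_analytic_def by metis
  \<comment> \<open>Convergence at the nonzero point \<open>r / 2\<close> makes the power series
    continuous at its centre.\<close>
  have "summable (\<lambda>n. c n * (r / 2) ^ n)"
    using r(2)[of "x0 + r / 2"] r(1) by (auto simp: sums_iff)
  then have "isCont (\<lambda>h. \<Sum>n. c n * h ^ n) 0"
    by (rule isCont_powser) (use r in auto)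
  then have "isCont (\<lambda>x. \<Sum>n. c n * (x - x0) ^ n) x0"
    by (intro isCont_o2[where g = "\<lambda>h. \<Sum>n. c n * h ^ n" and f = "\<lambda>x. x - x0"]) auto
  moreover have "eventually (\<lambda>x. (\<Sum>n. c n * (x - x0) ^ n) = u x) (nhds x0)"
    using r by (auto simp: eventually_nhds_metric dist_real_def sums_iff intro!: exI[of _ r])
  ultimately show "isCont u x0"
    by (simp add: isCont_cong)
qed

text \<open>If \<open>\<mu> < \<nu>\<close>, then \<open>\<mu>\<close> is counted below
  \<open>\<nu>\<close> but not below itself, so the two counts differ.\<close>

lemma nth_eigenvalue_unique:
  assumes "nth_eigenvalue M A n \<mu>" "nth_eigenvalue M A n \<nu>"
  shows "\<mu> = \<nu>"
proof -
  have False if "nth_eigenvalue M A n \<mu>" "nth_eigenvalue M A n \<nu>" "\<mu> < \<nu>" for \<mu> \<nu>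
  proof -
    have "{\<kappa>. eigenvalue M A \<kappa> \<and> \<kappa> < \<mu>} \<subset> {\<kappa>. eigenvalue M A \<kappa> \<and> \<kappa> < \<nu>}"
      using that by (auto simp: nth_eigenvalue_def)
    then have "card {\<kappa>. eigenvalue M A \<kappa> \<and> \<kappa> < \<mu>} < card {\<kappa>. eigenvalue M A \<kappa> \<and> \<kappa> < \<nu>}"
      by (rule psubset_card_mono[rotated]) (use that in \<open>simp add: nth_eigenvalue_def\<close>)
    with that show False by (simp add: nth_eigenvalue_def)
  qed
  then show ?thesis using assms by (meson linorder_less_linear)
qed

text \<open>Translation by \<open>c\<close> is injective and preserves order, so it carries the
  smaller eigenvalues of one operator onto those of the other.\<close>

lemma nth_eigenvalue_shift:
  assumes "\<And>\<mu>. eigenvalue N B (\<mu> + c) \<longleftrightarrow> eigenvalue M A \<mu>"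
  shows "nth_eigenvalue N B n (\<mu> + c) \<longleftrightarrow> nth_eigenvalue M A n \<mu>"
proof -
  have "{\<nu>. eigenvalue N B \<nu> \<and> \<nu> < \<mu> + c} = (\<lambda>\<nu>. \<nu> + c) ` {\<nu>. eigenvalue M A \<nu> \<and> \<nu> < \<mu>}"
  proof (intro set_eqI iffI)
    fix \<nu> assume "\<nu> \<in> {\<nu>. eigenvalue N B \<nu> \<and> \<nu> < \<mu> + c}"
    then show "\<nu> \<in> (\<lambda>\<nu>. \<nu> + c) ` {\<nu>. eigenvalue M A \<nu> \<and> \<nu> < \<mu>}"
      using assms[of "\<nu> - c"] by (intro image_eqI[of _ _ "\<nu> - c"]) simp_all
  qed (use assms in auto)
  moreover have "inj_on (\<lambda>\<nu>. \<nu> + c) X" for X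
    by simp
  ultimately show ?thesis
    unfolding nth_eigenvalue_def assms by (simp add: card_image finite_image_iff)
qed

theorem theorem1p2:
  fixes u1 u2 q u p :: "real \<Rightarrow> real" and c0 :: real and a b :: bparam
  assumes U: "condition_U u1 u2"
    and q: "q \<in> W10"
    and u: "u = (\<lambda>x. u1 (q x) + u2 (primitive q x))"
    and c0: "c0 = (LINT t:{0..1}|lebesgue. ((q t)\<^sup>2 + u t))"
    and p: "p = (\<lambda>x. wderiv q x + (q x)\<^sup>2 + u x - c0)"
  shows "unitarily_equivalent
           unit_interval_measure (add_const (schroedinger p a b) c0)
           (weighted (\<lambda>x. (rho q x)\<^sup>2)) (neg_laplacian q u a b)
       \<and> (\<forall>\<mu>. eigenvalue (weighted (\<lambda>x. (rho q x)\<^sup>2)) (neg_laplacian q u a b) (\<mu> + c0)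
           \<longleftrightarrow> eigenvalue unit_interval_measure (schroedinger p a b) \<mu>)
       \<and> (\<forall>n \<mu>. nth_eigenvalue (weighted (\<lambda>x. (rho q x)\<^sup>2)) (neg_laplacian q u a b) n (\<mu> + c0)
           \<longleftrightarrow> nth_eigenvalue unit_interval_measure (schroedinger p a b) n \<mu>)
       \<and> (a = Infinite \<or> b \<noteq> Infinite \<longrightarrow>
           (\<forall>n f y. nth_eigenfunction (weighted (\<lambda>x. (rho q x)\<^sup>2)) (neg_laplacian q u a b) n f \<and>
                    nth_eigenfunction unit_interval_measure (schroedinger p a b) n y \<longrightarrow>
                    norming_laplacian q a b f = norming_schroedinger a b y))"
proof -
  let ?W = "weighted (\<lambda>x. (rho q x)\<^sup>2)" and ?L = "neg_laplacian q u a b"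
    and ?S = "schroedinger p a b"
  have c: "continuous_on {0..1} q"
    by (rule has_l2_deriv_continuous[OF W10_has_l2_deriv[OF q]])
  have unitary: "unitarily_equivalent unit_interval_measure (add_const ?S c0) ?W ?L"
    unfolding unitarily_equivalent_def
    using gauge_unitary[OF c] gauge_op_graph[OF q p] by blast
  have eigenfunction: "eigenfunction unit_interval_measure ?S \<mu> (\<lambda>x. rho q x * f x)"
    if "eigenfunction ?W ?L (\<mu> + c0) f" for \<mu> f
    using gauge_eigenfunction[OF q p, of a b \<mu> "\<lambda>x. rho q x * f x"] that by simp
  have eigenvalue: "eigenvalue ?W ?L (\<mu> + c0) \<longleftrightarrow> eigenvalue unit_interval_measure ?S \<mu>" for \<mu>
    unfolding eigenvalue_def using eigenfunction gauge_eigenfunction[OF q p] by blast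
  have nth: "nth_eigenvalue ?W ?L n (\<mu> + c0) \<longleftrightarrow> nth_eigenvalue unit_interval_measure ?S n \<mu>" for n \<mu>
    by (rule nth_eigenvalue_shift[OF eigenvalue])
  have "norming_laplacian q a b f = norming_schroedinger a b y"
    if ab: "a = Infinite \<or> b \<noteq> Infinite" and f: "nth_eigenfunction ?W ?L n f"
      and y: "nth_eigenfunction unit_interval_measure ?S n y" for n f y
  proof -
    obtain \<nu> where \<nu>: "nth_eigenvalue ?W ?L n \<nu>" "eigenfunction ?W ?L \<nu> f"
      using f unfolding nth_eigenfunction_def by blast
    obtain \<mu> where \<mu>: "nth_eigenvalue unit_interval_measure ?S n \<mu>"
      "eigenfunction unit_interval_measure ?S \<mu> y"
      using y unfolding nth_eigenfunction_def by blast
    have "\<nu> = \<mu> + c0"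
      \<comment> \<open>Sharing the index \<open>n\<close> is what ties the two separately obtained
        eigenvalues together.\<close>
      using nth \<mu>(1) \<nu>(1) nth_eigenvalue_unique by blast
    then have z: "eigenfunction unit_interval_measure ?S \<mu> (\<lambda>x. rho q x * f x)"
      using eigenfunction \<nu>(2) by blast
    have an: "real_analytic u1" "real_analytic u2"
      using U unfolding condition_U_def by blast+
    have cQ: "continuous_on {0..1} (primitive q)"
      using primitive_has_vector_derivative[OF c] by (intro continuous_on_vector_derivative) auto
    have "continuous_on {0..1} (\<lambda>x. (q x)\<^sup>2 + u x - c0)"
      unfolding u
      by (intro continuous_intros c continuous_on_compose2[OF real_analytic_continuous[OF an(1), of UNIV] c]
          continuous_on_compose2[OF real_analytic_continuous[OF an(2), of UNIV] cQ] subset_UNIV)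
    from lspace_add[OF _ lspace_continuous[OF this], of "wderiv q"]
    have "p absolutely_integrable_on {0..1}"
      using W10_has_l2_deriv[OF q] unfolding p has_l2_deriv_def
      by (intro lspace_absolutely_integrable) (simp add: algebra_simps)
    then obtain k where k: "k \<noteq> 0" "\<And>x. x \<in> {0..1} \<Longrightarrow> rho q x * f x = k * y x"
      using schroedinger_eigenfunctions_proportional[OF _ \<mu>(2) z] by blast
    have diff: "f differentiable_on {0..1}" "y differentiable_on {0..1}"
      using \<nu>(2) \<mu>(2) by (auto simp: eigenfunction_def schroedinger_def neg_laplacian_def)
    have D: "rho q x * (D f x + q x * f x) = k * D y x" if "x \<in> {0..1}" for x
      using D_cong_scaled[OF diff(2) k(2) that] that
        D_eqI[OF inverse_gauge_has_vector_derivative[OF c diff(1)], of x] by simp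
    \<comment> \<open>At the end points \<open>q\<close> vanishes, so the term \<open>q f\<close>
      drops out of the derivative; at 0 also \<open>rho\<close> is 1. Each norming quotient divides
      two of these identities.\<close>
    have "D f 0 = k * D y 0" "rho q 1 * D f 1 = k * D y 1" "f 0 = k * y 0" "rho q 1 * f 1 = k * y 1"
      using D[of 0] D[of 1] k(2)[of 0] k(2)[of 1] W10_zero[OF q] by auto
    then show ?thesis
      using k(1) ab by (cases a; cases b) auto
  qed
  with unitary eigenvalue nth show ?thesis by blast
qed

end
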